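(* Let $\mathcal{R}$ be a commutative ring with unit, $\mathcal{A}$ an associative commutative $\mathcal{R}$-algebra with unit, and $\mathcal{F}$ a faithful $\mathcal{A}$-module. Let $B:\mathcal{F}\times\mathcal{F}\to\mathcal{F}$ be an $\mathcal{R}$-bilinear form, and let $\mathcal{F}_B=\{(ad^L_X,X): X\in\mathcal{F}\}\subseteq \mathfrak{gl}(\mathcal{F})\times\mathcal{F}$ be its graph, where $ad^L_X(Y)=B(X,Y)$. Then $\mathcal{F}_B$ is closed under the bracket $\{(\Phi,X),(\Psi,Y)\}=([\Phi,\Psi],\Phi Y)$ on $\mathfrak{gl}(\mathcal{F})\times\mathcal{F}$ if and only if $(\mathcal{F},B)$ is a left Loday algebra. Moreover, if $B$ is antisymmetric, then $\mathcal{F}_B$ is closed under $\{\;,\;\}$ if and only if $(\mathcal{F},B)$ is a Lie algebra.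
   Context: $\mathcal{F}$ is regarded as an $\mathcal{R}$-module via $\mathcal{R}\to\mathcal{A}$. $\mathfrak{gl}(\mathcal{F})=End_{\mathcal{R}}(\mathcal{F})$ is the space of $\mathcal{R}$-linear endomorphisms of $\mathcal{F}$, and $[\Phi,\Psi]=\Phi\circ\Psi-\Psi\circ\Phi$. Closed under $\{\;,\;\}$ means that the bracket of any two elements of $\mathcal{F}_B$ lies in $\mathcal{F}_B$. $(\mathcal{F},B)$ with $B$ $\mathcal{R}$-bilinear is a left Loday algebra if $B(X,B(Y,Z))=B(B(X,Y),Z)+B(Y,B(X,Z))$ for all $X,Y,Z\in\mathcal{F}$. Antisymmetric means $B(X,Y)=-B(Y,X)$ for all $X,Y$. $(\mathcal{F},B)$ is a Lie algebra if $B$ is $\mathcal{R}$-bilinear, antisymmetric and satisfies the Jacobi identity $B(X,B(Y,Z))+B(Z,B(X,Y))+B(Y,B(Z,X))=0$. *)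

theory Defs
  imports "HOL-Algebra.Module"
begin

locale faithful_module = module +
  assumes faithful:
    "\<lbrakk>a \<in> carrier R; \<And>x. x \<in> carrier M \<Longrightarrow> a \<odot>\<^bsub>M\<^esub> x = \<zero>\<^bsub>M\<^esub>\<rbrakk> \<Longrightarrow> a = \<zero>"

(* An A-module F as a module over the base ring of the algebra A, along the structure map
   sending r to r \<odot> \<one> in A.  The ring fields mult and one of a module record carry no meaning. *)
definition restrict_scalars ::
  "('r, 'a, 'm) module_scheme \<Rightarrow> ('a, 'f, 'n) module_scheme \<Rightarrow> ('r, 'f) module" where
  "restrict_scalars A F =
    \<lparr>carrier = carrier F, mult = mult F, one = one F, zero = zero F, add = add F,
     smult = (\<lambda>r x. (r \<odot>\<^bsub>A\<^esub> \<one>\<^bsub>A\<^esub>) \<odot>\<^bsub>F\<^esub> x)\<rparr>"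

lemma module_restrict_scalars:
  assumes "algebra R A" and "module A F"
  shows "module R (restrict_scalars A F)"
proof -
  interpret A: algebra R A by fact
  interpret F: module A F by fact
  have grp: "abelian_group (restrict_scalars A F)"
    by (rule abelian_groupI)
      (auto simp: restrict_scalars_def F.M.a_ac intro: F.l_neg F.a_inv_closed)
  show ?thesis
  proof (rule moduleI[OF A.R_cring grp])
    fix a b x assume *: "a \<in> carrier R" "b \<in> carrier R" "x \<in> carrier (restrict_scalars A F)"
    have "(a \<odot>\<^bsub>A\<^esub> \<one>\<^bsub>A\<^esub>) \<otimes>\<^bsub>A\<^esub> (b \<odot>\<^bsub>A\<^esub> \<one>\<^bsub>A\<^esub>) = (a \<otimes>\<^bsub>R\<^esub> b) \<odot>\<^bsub>A\<^esub> \<one>\<^bsub>A\<^esub>"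
      using * by (simp add: A.smult_assoc2 A.smult_assoc1)
    then show "(a \<otimes>\<^bsub>R\<^esub> b) \<odot>\<^bsub>restrict_scalars A F\<^esub> x =
        a \<odot>\<^bsub>restrict_scalars A F\<^esub> (b \<odot>\<^bsub>restrict_scalars A F\<^esub> x)"
      using * by (simp add: restrict_scalars_def F.smult_assoc1[symmetric])
  qed (auto simp: restrict_scalars_def A.smult_l_distr F.smult_l_distr F.smult_r_distr)
qed

definition linear_endomorphism ::
  "('r, 'k) ring_scheme \<Rightarrow> ('r, 'f, 'n) module_scheme \<Rightarrow> ('f \<Rightarrow> 'f) \<Rightarrow> bool" where
  "linear_endomorphism R M \<Phi> \<longleftrightarrow>
    \<Phi> \<in> carrier M \<rightarrow> carrier M \<and>
    (\<forall>x\<in>carrier M. \<forall>y\<in>carrier M. \<Phi> (x \<oplus>\<^bsub>M\<^esub> y) = \<Phi> x \<oplus>\<^bsub>M\<^esub> \<Phi> y) \<and>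
    (\<forall>r\<in>carrier R. \<forall>x\<in>carrier M. \<Phi> (r \<odot>\<^bsub>M\<^esub> x) = r \<odot>\<^bsub>M\<^esub> \<Phi> x)"

(* Endomorphisms are extensional, so that HOL equality is equality of maps on the carrier. *)
definition gl :: "('r, 'k) ring_scheme \<Rightarrow> ('r, 'f, 'n) module_scheme \<Rightarrow> ('f \<Rightarrow> 'f) set" where
  "gl R M = {\<Phi> \<in> extensional (carrier M). linear_endomorphism R M \<Phi>}"

definition commutator ::
  "('r, 'f, 'n) module_scheme \<Rightarrow> ('f \<Rightarrow> 'f) \<Rightarrow> ('f \<Rightarrow> 'f) \<Rightarrow> ('f \<Rightarrow> 'f)" where
  "commutator M \<Phi> \<Psi> =
    (\<lambda>x\<in>carrier M. compose (carrier M) \<Phi> \<Psi> x \<ominus>\<^bsub>M\<^esub> compose (carrier M) \<Psi> \<Phi> x)"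

definition gl_bracket ::
  "('r, 'f, 'n) module_scheme \<Rightarrow> ('f \<Rightarrow> 'f) \<times> 'f \<Rightarrow> ('f \<Rightarrow> 'f) \<times> 'f \<Rightarrow> ('f \<Rightarrow> 'f) \<times> 'f" where
  "gl_bracket M = (\<lambda>(\<Phi>, X) (\<Psi>, Y). (commutator M \<Phi> \<Psi>, \<Phi> Y))"

definition closed_under_bracket ::
  "('r, 'f, 'n) module_scheme \<Rightarrow> (('f \<Rightarrow> 'f) \<times> 'f) set \<Rightarrow> bool" where
  "closed_under_bracket M S \<longleftrightarrow> (\<forall>p\<in>S. \<forall>q\<in>S. gl_bracket M p q \<in> S)"

definition bilinear_form ::
  "('r, 'k) ring_scheme \<Rightarrow> ('r, 'f, 'n) module_scheme \<Rightarrow> ('f \<Rightarrow> 'f \<Rightarrow> 'f) \<Rightarrow> bool" where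
  "bilinear_form R M B \<longleftrightarrow>
    (\<forall>x\<in>carrier M. linear_endomorphism R M (\<lambda>y. B x y)) \<and>
    (\<forall>y\<in>carrier M. linear_endomorphism R M (\<lambda>x. B x y))"

definition ad_L ::
  "('r, 'f, 'n) module_scheme \<Rightarrow> ('f \<Rightarrow> 'f \<Rightarrow> 'f) \<Rightarrow> 'f \<Rightarrow> ('f \<Rightarrow> 'f)" where
  "ad_L M B X = (\<lambda>Y\<in>carrier M. B X Y)"

definition ad_graph ::
  "('r, 'f, 'n) module_scheme \<Rightarrow> ('f \<Rightarrow> 'f \<Rightarrow> 'f) \<Rightarrow> (('f \<Rightarrow> 'f) \<times> 'f) set" where
  "ad_graph M B = {(ad_L M B X, X) | X. X \<in> carrier M}"

definition left_loday_algebra ::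
  "('r, 'k) ring_scheme \<Rightarrow> ('r, 'f, 'n) module_scheme \<Rightarrow> ('f \<Rightarrow> 'f \<Rightarrow> 'f) \<Rightarrow> bool" where
  "left_loday_algebra R M B \<longleftrightarrow>
    bilinear_form R M B \<and>
    (\<forall>X\<in>carrier M. \<forall>Y\<in>carrier M. \<forall>Z\<in>carrier M.
      B X (B Y Z) = B (B X Y) Z \<oplus>\<^bsub>M\<^esub> B Y (B X Z))"

definition antisymmetric_form ::
  "('r, 'f, 'n) module_scheme \<Rightarrow> ('f \<Rightarrow> 'f \<Rightarrow> 'f) \<Rightarrow> bool" where
  "antisymmetric_form M B \<longleftrightarrow>
    (\<forall>X\<in>carrier M. \<forall>Y\<in>carrier M. B X Y = \<ominus>\<^bsub>M\<^esub> B Y X)"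

definition lie_algebra ::
  "('r, 'k) ring_scheme \<Rightarrow> ('r, 'f, 'n) module_scheme \<Rightarrow> ('f \<Rightarrow> 'f \<Rightarrow> 'f) \<Rightarrow> bool" where
  "lie_algebra R M B \<longleftrightarrow>
    bilinear_form R M B \<and> antisymmetric_form M B \<and>
    (\<forall>X\<in>carrier M. \<forall>Y\<in>carrier M. \<forall>Z\<in>carrier M.
      B X (B Y Z) \<oplus>\<^bsub>M\<^esub> B Z (B X Y) \<oplus>\<^bsub>M\<^esub> B Y (B Z X) = \<zero>\<^bsub>M\<^esub>)"

lemma ad_graph_subset:
  assumes "module R M" and "bilinear_form R M B"
  shows "ad_graph M B \<subseteq> gl R M \<times> carrier M"
proof -
  interpret module R M by fact
  show ?thesis
    using assms(2)
    by (auto simp: ad_graph_def gl_def ad_L_def bilinear_form_def linear_endomorphism_def)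
qed

lemma gl_bracket_closed:
  assumes "module R M" and "p \<in> gl R M \<times> carrier M" and "q \<in> gl R M \<times> carrier M"
  shows "gl_bracket M p q \<in> gl R M \<times> carrier M"
proof -
  interpret module R M by fact
  obtain \<Phi> X \<Psi> Y where pq: "p = (\<Phi>, X)" "q = (\<Psi>, Y)" by (metis surj_pair)
  have *: "linear_endomorphism R M \<Phi>" "linear_endomorphism R M \<Psi>" "Y \<in> carrier M"
    using assms(2,3) by (auto simp: pq gl_def)
  then have c: "\<And>x. x \<in> carrier M \<Longrightarrow> \<Phi> x \<in> carrier M" "\<And>x. x \<in> carrier M \<Longrightarrow> \<Psi> x \<in> carrier M"
    by (auto simp: linear_endomorphism_def)
  have "linear_endomorphism R M (commutator M \<Phi> \<Psi>)"
    using * c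
    by (auto simp: linear_endomorphism_def commutator_def compose_eq a_minus_def
        smult_r_distr smult_r_minus M.minus_add M.a_ac)
  then show ?thesis
    using * c by (simp add: pq gl_bracket_def gl_def commutator_def)
qed

end

theory Submission
  imports Defs
begin

text \<open>Used twice: to move one term of the Loday identity across the equation, and with
  \<open>c\<close> zero to read a vanishing difference as an equality.\<close>

lemma (in abelian_group) minus_eq_iff_eq_add:
  assumes "a \<in> carrier G" and "b \<in> carrier G" and "c \<in> carrier G"
  shows "a \<ominus> b = c \<longleftrightarrow> a = c \<oplus> b"
  using assms by (auto simp: a_minus_def a_assoc l_neg r_neg)

lemma bilinear_form_closed:
  assumes "bilinear_form R M B" and "X \<in> carrier M" and "Y \<in> carrier M"
  shows "B X Y \<in> carrier M"
  using assms by (auto simp: bilinear_form_def linear_endomorphism_def)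

text \<open>Negation is the action of the scalar \<open>\<ominus> \<one>\<close>, so homogeneity
  carries it through \<open>\<Phi>\<close>.\<close>

lemma (in module) linear_endomorphism_a_inv:
  assumes "linear_endomorphism R M \<Phi>" and "x \<in> carrier M"
  shows "\<Phi> (\<ominus>\<^bsub>M\<^esub> x) = \<ominus>\<^bsub>M\<^esub> \<Phi> x"
proof -
  have "\<ominus> \<one> \<in> carrier R" by simp
  then have "\<Phi> ((\<ominus> \<one>) \<odot>\<^bsub>M\<^esub> x) = (\<ominus> \<one>) \<odot>\<^bsub>M\<^esub> \<Phi> x" and "\<Phi> x \<in> carrier M"
    using assms by (auto simp: linear_endomorphism_def)
  then show ?thesis
    using assms(2) by (simp add: smult_l_minus)
qed

text \<open>The second component of the bracket of \<open>(ad\<^sup>L\<^sub>X, X)\<close> and \<open>(ad\<^sup>L\<^sub>Y, Y)\<close> is \<open>B X Y\<close>, which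
  leaves only one candidate in the graph: closedness says that \<open>ad\<^sup>L\<close> turns \<open>B\<close> into the
  commutator.\<close>

lemma closed_ad_graph_iff_commutator:
  "closed_under_bracket M (ad_graph M B) \<longleftrightarrow>
    (\<forall>X\<in>carrier M. \<forall>Y\<in>carrier M.
      B X Y \<in> carrier M \<and> commutator M (ad_L M B X) (ad_L M B Y) = ad_L M B (B X Y))"
  by (auto simp: closed_under_bracket_def ad_graph_def gl_bracket_def ad_L_def)

lemma ad_L_apply: "Y \<in> carrier M \<Longrightarrow> ad_L M B X Y = B X Y"
  by (simp add: ad_L_def)

lemma (in module) commutator_ad_L_apply:
  assumes "bilinear_form R M B"
    and "X \<in> carrier M" and "Y \<in> carrier M" and "Z \<in> carrier M"
  shows "commutator M (ad_L M B X) (ad_L M B Y) Z = B X (B Y Z) \<ominus>\<^bsub>M\<^esub> B Y (B X Z)"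
  using assms by (simp add: commutator_def compose_eq ad_L_apply bilinear_form_closed)

text \<open>Evaluated at \<open>Z\<close>, the commutator condition on \<open>X\<close> and
  \<open>Y\<close> is the Loday identity for \<open>X\<close>, \<open>Y\<close>, \<open>Z\<close>
  with \<open>B Y (B X Z)\<close> moved to the left-hand side.\<close>

lemma (in module) closed_ad_graph_iff_left_loday:
  assumes B: "bilinear_form R M B"
  shows "closed_under_bracket M (ad_graph M B) \<longleftrightarrow> left_loday_algebra R M B"
proof -
  note cl = bilinear_form_closed[OF B]
  have "commutator M (ad_L M B X) (ad_L M B Y) = ad_L M B (B X Y) \<longleftrightarrow>
      (\<forall>Z\<in>carrier M. B X (B Y Z) = B (B X Y) Z \<oplus>\<^bsub>M\<^esub> B Y (B X Z))"
    if X: "X \<in> carrier M" and Y: "Y \<in> carrier M" for X Y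
  proof -
    \<comment> \<open>Both maps are restricted to the carrier, so agreement there already makes them
      equal as HOL functions.\<close>
    have "commutator M (ad_L M B X) (ad_L M B Y) = ad_L M B (B X Y) \<longleftrightarrow>
        (\<forall>Z\<in>carrier M. commutator M (ad_L M B X) (ad_L M B Y) Z = ad_L M B (B X Y) Z)"
      by (intro iffI extensionalityI[where A = "carrier M"]) (simp_all add: commutator_def ad_L_def)
    also have "\<dots> \<longleftrightarrow> (\<forall>Z\<in>carrier M. B X (B Y Z) \<ominus>\<^bsub>M\<^esub> B Y (B X Z) = B (B X Y) Z)"
      using X Y by (simp add: commutator_ad_L_apply[OF B] ad_L_apply)
    also have "\<dots> \<longleftrightarrow> (\<forall>Z\<in>carrier M. B X (B Y Z) = B (B X Y) Z \<oplus>\<^bsub>M\<^esub> B Y (B X Z))"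
    proof (rule ball_cong[OF refl])
      fix Z assume Z: "Z \<in> carrier M"
      have *: "B X (B Y Z) \<in> carrier M" "B Y (B X Z) \<in> carrier M" "B (B X Y) Z \<in> carrier M"
        using X Y Z by (simp_all add: cl)
      show "B X (B Y Z) \<ominus>\<^bsub>M\<^esub> B Y (B X Z) = B (B X Y) Z \<longleftrightarrow>
          B X (B Y Z) = B (B X Y) Z \<oplus>\<^bsub>M\<^esub> B Y (B X Z)"
        using * by (rule M.minus_eq_iff_eq_add)
    qed
    finally show ?thesis .
  qed
  then show ?thesis
    using B cl
    by (simp add: closed_ad_graph_iff_commutator left_loday_algebra_def)
qed

text \<open>Antisymmetry turns the last two Jacobi terms into the negatives of the two terms on the
  right of the Loday identity. The Jacobi sum is then the difference of the two sides of that
  identity.\<close>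

lemma (in module) left_loday_iff_lie:
  assumes B: "bilinear_form R M B" and anti: "antisymmetric_form M B"
  shows "left_loday_algebra R M B \<longleftrightarrow> lie_algebra R M B"
proof -
  note cl = bilinear_form_closed[OF B]
  have "B X (B Y Z) = B (B X Y) Z \<oplus>\<^bsub>M\<^esub> B Y (B X Z) \<longleftrightarrow>
      B X (B Y Z) \<oplus>\<^bsub>M\<^esub> B Z (B X Y) \<oplus>\<^bsub>M\<^esub> B Y (B Z X) = \<zero>\<^bsub>M\<^esub>"
    if X: "X \<in> carrier M" and Y: "Y \<in> carrier M" and Z: "Z \<in> carrier M" for X Y Z
  proof -
    define a b c where "a = B X (B Y Z)" and "b = B (B X Y) Z" and "c = B Y (B X Z)"
    have mem: "a \<in> carrier M" "b \<in> carrier M" "c \<in> carrier M"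
      using X Y Z by (simp_all add: cl a_def b_def c_def)
    have b: "B Z (B X Y) = \<ominus>\<^bsub>M\<^esub> b"
      using anti Z cl[OF X Y] unfolding antisymmetric_form_def b_def by blast
    \<comment> \<open>Here the swap occurs inside the second argument of \<open>B Y\<close>;
      linearity of \<open>B Y\<close> then brings the sign outside.\<close>
    have "B Z X = \<ominus>\<^bsub>M\<^esub> B X Z"
      using anti X Z unfolding antisymmetric_form_def by blast
    moreover have "linear_endomorphism R M (B Y)"
      using B Y by (simp add: bilinear_form_def)
    ultimately have c: "B Y (B Z X) = \<ominus>\<^bsub>M\<^esub> c"
      using X Z cl by (simp add: linear_endomorphism_a_inv c_def)
    have "a \<oplus>\<^bsub>M\<^esub> \<ominus>\<^bsub>M\<^esub> b \<oplus>\<^bsub>M\<^esub> \<ominus>\<^bsub>M\<^esub> c = a \<ominus>\<^bsub>M\<^esub> (b \<oplus>\<^bsub>M\<^esub> c)"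
      using mem by (simp add: a_minus_def M.minus_add M.a_assoc)
    then show ?thesis
      using mem unfolding b c a_def[symmetric] b_def[symmetric] c_def[symmetric]
      by (simp add: M.minus_eq_iff_eq_add)
  qed
  then show ?thesis
    using B anti by (simp add: left_loday_algebra_def lie_algebra_def)
qed

theorem proposition2:
  fixes R :: "('r, 'k) ring_scheme"
    and A :: "('r, 'a, 'm) module_scheme"
    and F :: "('a, 'f, 'n) module_scheme"
    and B :: "'f \<Rightarrow> 'f \<Rightarrow> 'f"
  assumes "cring R"
    and "algebra R A"
    and "faithful_module A F"
    and "bilinear_form R (restrict_scalars A F) B"
  shows "(closed_under_bracket (restrict_scalars A F) (ad_graph (restrict_scalars A F) B)
            \<longleftrightarrow> left_loday_algebra R (restrict_scalars A F) B)
       \<and> (antisymmetric_form (restrict_scalars A F) B \<longrightarrow>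
           (closed_under_bracket (restrict_scalars A F) (ad_graph (restrict_scalars A F) B)
            \<longleftrightarrow> lie_algebra R (restrict_scalars A F) B))"
proof -
  \<comment> \<open>Both equivalences are statements about an \<open>R\<close>-module with a
    bilinear form; restriction of scalars supplies that structure on \<open>F\<close>.\<close>
  interpret module R "restrict_scalars A F"
    using assms(2,3) by (intro module_restrict_scalars) (simp_all add: faithful_module_def)
  show ?thesis
    using closed_ad_graph_iff_left_loday[OF assms(4)] left_loday_iff_lie[OF assms(4)] by simp
qed

end
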